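(* Let $r,c,n$ be integers with $0\le r\le c\le n$, and let $M=M(n;r,c)$ and $M^*$ be the matrices defined in the context. Then $M^*$ is the Moore-Penrose inverse of $M$, i.e. $M^+=M^*$.
   Context: Let $[n]=\{1,\dots,n\}$. The set inclusion incidence matrix $M=M(n;r,c)$ is the $\binom{n}{r}\times\binom{n}{c}$ real matrix whose rows are indexed by the $r$-subsets $R$ of $[n]$, whose columns are indexed by the $c$-subsets $C$ of $[n]$, and whose $(R,C)$-entry is $1$ if $R\subseteq C$ and $0$ otherwise. Let $N=\max\{n,r+c\}$. Let $M^*$ be the $\binom{n}{c}\times\binom{n}{r}$ matrix with rows indexed by $c$-subsets $C$ and columns indexed by $r$-subsets $R$ of $[n]$, with entries $$M^*_{C,R}=(-1)^{r-i}\frac{\binom{c-i-1}{r-i}}{\binom{N-r}{c-r}\binom{N-c}{r-i}},\qquad i=|R\cap C|.$$ Binomial coefficients $\binom{a}{b}$ with integer $a$ and integer $b\ge 0$ are understood as $a(a-1)\cdots(a-b+1)/b!$ (so e.g. $\binom{-1}{0}=1$). The Moore-Penrose inverse $A^+$ of a real $m\times n$ matrix $A$ is the unique $n\times m$ matrix $G$ with $AGA=A$, $GAG=G$, $(AG)^T=AG$, $(GA)^T=GA$. *)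

theory Defs
  imports Complex_Main
begin

text \<open>
  A real matrix with rows indexed by a finite set \<open>I\<close> and columns indexed by a finite set \<open>J\<close> is a
  function vanishing outside \<open>I \<times> J\<close>; equality of such matrices is then equality of functions.
\<close>

definition idx_mats :: "'i set \<Rightarrow> 'j set \<Rightarrow> ('i \<Rightarrow> 'j \<Rightarrow> real) set" where
  "idx_mats I J = {A. \<forall>i j. \<not> (i \<in> I \<and> j \<in> J) \<longrightarrow> A i j = 0}"

definition idx_mat :: "'i set \<Rightarrow> 'j set \<Rightarrow> ('i \<Rightarrow> 'j \<Rightarrow> real) \<Rightarrow> 'i \<Rightarrow> 'j \<Rightarrow> real" where
  "idx_mat I J f = (\<lambda>i j. if i \<in> I \<and> j \<in> J then f i j else 0)"

definition idx_mult ::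
    "'j set \<Rightarrow> ('i \<Rightarrow> 'j \<Rightarrow> real) \<Rightarrow> ('j \<Rightarrow> 'k \<Rightarrow> real) \<Rightarrow> 'i \<Rightarrow> 'k \<Rightarrow> real" where
  "idx_mult J A B = (\<lambda>i k. \<Sum>j\<in>J. A i j * B j k)"

definition idx_transpose :: "('i \<Rightarrow> 'j \<Rightarrow> real) \<Rightarrow> 'j \<Rightarrow> 'i \<Rightarrow> real" where
  "idx_transpose A = (\<lambda>j i. A i j)"

definition is_moore_penrose ::
    "'i set \<Rightarrow> 'j set \<Rightarrow> ('i \<Rightarrow> 'j \<Rightarrow> real) \<Rightarrow> ('j \<Rightarrow> 'i \<Rightarrow> real) \<Rightarrow> bool" where
  "is_moore_penrose I J A G \<longleftrightarrow>
     A \<in> idx_mats I J \<and> G \<in> idx_mats J I \<and>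
     idx_mult I (idx_mult J A G) A = A \<and>
     idx_mult J (idx_mult I G A) G = G \<and>
     idx_transpose (idx_mult J A G) = idx_mult J A G \<and>
     idx_transpose (idx_mult I G A) = idx_mult I G A"

definition moore_penrose ::
    "'i set \<Rightarrow> 'j set \<Rightarrow> ('i \<Rightarrow> 'j \<Rightarrow> real) \<Rightarrow> 'j \<Rightarrow> 'i \<Rightarrow> real" where
  "moore_penrose I J A = (THE G. is_moore_penrose I J A G)"

definition subsets_of_size :: "nat \<Rightarrow> nat \<Rightarrow> nat set set" where
  "subsets_of_size n k = {S. S \<subseteq> {1..n} \<and> card S = k}"

definition inclusion_matrix :: "nat \<Rightarrow> nat \<Rightarrow> nat \<Rightarrow> nat set \<Rightarrow> nat set \<Rightarrow> real" where
  "inclusion_matrix n r c =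
     idx_mat (subsets_of_size n r) (subsets_of_size n c) (\<lambda>R C. if R \<subseteq> C then 1 else 0)"

text \<open>
  The upper argument \<open>c - i - 1\<close> equals \<open>-1\<close> when \<open>i = r = c\<close>, so the subtractions there are taken in
  the reals and the binomial coefficients are generalized ones. The lower arguments are natural
  numbers: \<open>i \<le> r \<le> c\<close>, so truncated subtraction is harmless there.
\<close>

definition inclusion_matrix_star :: "nat \<Rightarrow> nat \<Rightarrow> nat \<Rightarrow> nat set \<Rightarrow> nat set \<Rightarrow> real" where
  "inclusion_matrix_star n r c =
     idx_mat (subsets_of_size n c) (subsets_of_size n r)
       (\<lambda>C R. let N = max n (r + c); i = card (R \<inter> C) in
          (-1) ^ (r - i) * ((real c - real i - 1) gchoose (r - i)) /
          (((real N - real r) gchoose (c - r)) * ((real N - real c) gchoose (r - i))))"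

end

theory Submission imports Defs begin

text \<open>
  Put \<open>a = c - r\<close>, \<open>b = N - c\<close>. The entry \<open>M*(C, R)\<close> is a function \<open>w\<close> of \<open>s = |R - C|\<close> alone, so
  \<open>(M M*)(R, R')\<close> depends only on \<open>|R' - R|\<close> and \<open>(M* M)(C, C')\<close> only on \<open>|C' - C|\<close>; both products are
  therefore symmetric. If \<open>n \<ge> r + c\<close> then \<open>M M* = 1\<close>, and if \<open>n \<le> r + c\<close> then \<open>M* M = 1\<close>. After
  passing to complements of the \<open>c\<close>-sets in the first case, both claims say that the sum of
  \<open>w |S \<inter> A|\<close> over the \<open>b\<close>-subsets \<open>S\<close> of an \<open>(a + b)\<close>-set containing an \<open>m\<close>-set \<open>A\<close> is \<open>1\<close> for \<open>m = 0\<close>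
  and \<open>0\<close> for \<open>0 < m \<le> b\<close>; for \<open>m > 0\<close> this sum is an \<open>m\<close>-th finite difference of a polynomial of
  degree \<open>m - 1\<close>.
\<close>

section \<open>Matrices and Moore-Penrose inverses\<close>

definition idx_one :: "'i set \<Rightarrow> 'i \<Rightarrow> 'i \<Rightarrow> real" where
  "idx_one I = idx_mat I I (\<lambda>i j. if i = j then 1 else 0)"

lemma idx_mult_assoc:
  "idx_mult K (idx_mult J A B) C = idx_mult J A (idx_mult K B C)"
proof (intro ext)
  fix i l
  have "idx_mult K (idx_mult J A B) C i l = (\<Sum>k\<in>K. \<Sum>j\<in>J. A i j * B j k * C k l)"
    by (simp add: idx_mult_def sum_distrib_right)
  also have "\<dots> = (\<Sum>j\<in>J. \<Sum>k\<in>K. A i j * B j k * C k l)"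
    by (rule sum.swap)
  also have "\<dots> = idx_mult J A (idx_mult K B C) i l"
    by (simp add: idx_mult_def sum_distrib_left mult.assoc)
  finally show "idx_mult K (idx_mult J A B) C i l = idx_mult J A (idx_mult K B C) i l" .
qed

lemma idx_transpose_mult:
  "idx_transpose (idx_mult J A B) = idx_mult J (idx_transpose B) (idx_transpose A)"
  by (simp add: idx_mult_def idx_transpose_def mult.commute)

lemma idx_one_mult:
  assumes "finite I" and "A \<in> idx_mats I J"
  shows "idx_mult I (idx_one I) A = A"
proof (intro ext)
  fix i j
  have "idx_mult I (idx_one I) A i j = (\<Sum>k\<in>I. if k = i then A i j else 0)"
    unfolding idx_mult_def idx_one_def idx_mat_def
    by (intro sum.cong) auto
  also have "\<dots> = A i j"
    using assms by (auto simp: idx_mats_def)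
  finally show "idx_mult I (idx_one I) A i j = A i j" .
qed

lemma idx_mult_one:
  assumes "finite J" and "A \<in> idx_mats I J"
  shows "idx_mult J A (idx_one J) = A"
proof (intro ext)
  fix i j
  have "idx_mult J A (idx_one J) i j = (\<Sum>k\<in>J. if k = j then A i j else 0)"
    unfolding idx_mult_def idx_one_def idx_mat_def
    by (intro sum.cong) auto
  also have "\<dots> = A i j"
    using assms by (auto simp: idx_mats_def)
  finally show "idx_mult J A (idx_one J) i j = A i j" .
qed

text \<open>With AG = 1, the first Penrose equation reads 1A = A and, after reassociation, the
  second reads G1 = G. This serves the case n \<ge> r + c.\<close>

lemma is_moore_penrose_right_inverse:
  assumes "finite I" "A \<in> idx_mats I J" "G \<in> idx_mats J I"
    and "idx_mult J A G = idx_one I"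
    and "idx_transpose (idx_mult J A G) = idx_mult J A G"
    and "idx_transpose (idx_mult I G A) = idx_mult I G A"
  shows "is_moore_penrose I J A G"
  using assms by (simp add: is_moore_penrose_def idx_one_mult idx_mult_one idx_mult_assoc[of J I G])

lemma is_moore_penrose_left_inverse:
  assumes "finite J" "A \<in> idx_mats I J" "G \<in> idx_mats J I"
    and "idx_mult I G A = idx_one J"
    and "idx_transpose (idx_mult J A G) = idx_mult J A G"
    and "idx_transpose (idx_mult I G A) = idx_mult I G A"
  shows "is_moore_penrose I J A G"
  using assms by (simp add: is_moore_penrose_def idx_one_mult idx_mult_one idx_mult_assoc[of I J A])

text \<open>Penrose's argument: AG = (AH)(AG) = ((AG)(AH))^T = (AH)^T = AH by symmetry, likewise GA
  = HA, and hence G = GAG = HAG = HAH = H.\<close>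

lemma is_moore_penrose_unique:
  assumes G: "is_moore_penrose I J A G" and H: "is_moore_penrose I J A H"
  shows "G = H"
proof -
  have symG: "idx_transpose (idx_mult J A G) = idx_mult J A G"
      "idx_transpose (idx_mult I G A) = idx_mult I G A"
    and symH: "idx_transpose (idx_mult J A H) = idx_mult J A H"
      "idx_transpose (idx_mult I H A) = idx_mult I H A"
    and AGA: "idx_mult I (idx_mult J A G) A = A" and AHA: "idx_mult I (idx_mult J A H) A = A"
    using G H by (simp_all add: is_moore_penrose_def)
  have left: "idx_mult J A G = idx_mult J A H"
  proof -
    have "idx_mult J A G = idx_mult J (idx_mult I (idx_mult J A H) A) G"
      by (simp only: AHA)
    also have "\<dots> = idx_mult I (idx_transpose (idx_mult J A H)) (idx_transpose (idx_mult J A G))"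
      by (simp only: symG symH idx_mult_assoc)
    also have "\<dots> = idx_transpose (idx_mult J (idx_mult I (idx_mult J A G) A) H)"
      by (simp only: idx_transpose_mult[symmetric] idx_mult_assoc)
    also have "\<dots> = idx_mult J A H"
      by (simp only: AGA symH)
    finally show ?thesis .
  qed
  have right: "idx_mult I G A = idx_mult I H A"
  proof -
    have "idx_mult I G A = idx_mult I G (idx_mult I (idx_mult J A H) A)"
      by (simp only: AHA)
    also have "\<dots> = idx_mult J (idx_transpose (idx_mult I G A)) (idx_transpose (idx_mult I H A))"
      by (simp only: symG symH idx_mult_assoc)
    also have "\<dots> = idx_transpose (idx_mult I H (idx_mult I (idx_mult J A G) A))"
      by (simp only: idx_transpose_mult[symmetric] idx_mult_assoc)
    also have "\<dots> = idx_mult I H A"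
      by (simp only: AGA symH)
    finally show ?thesis .
  qed
  have "G = idx_mult J (idx_mult I G A) G"
    using G by (simp add: is_moore_penrose_def)
  also have "\<dots> = idx_mult I H (idx_mult J A G)"
    by (simp add: right idx_mult_assoc)
  also have "\<dots> = idx_mult J (idx_mult I H A) H"
    by (simp add: left idx_mult_assoc)
  also have "\<dots> = H"
    using H by (simp add: is_moore_penrose_def)
  finally show ?thesis .
qed

lemma moore_penrose_eqI:
  assumes "is_moore_penrose I J A G"
  shows "moore_penrose I J A = G"
  unfolding moore_penrose_def using assms is_moore_penrose_unique[OF _ assms] by (rule the_equality)

section \<open>The binomial identity\<close>

text \<open>Pascal's rule, read as the recursion for iterated finite differences: one difference is
  moved from the binomial weights onto \<open>f\<close>.\<close>

lemma alternating_sum_binomial_Suc: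
  fixes f :: "nat \<Rightarrow> 'a::comm_ring_1"
  shows "(\<Sum>k\<le>Suc m. (-1) ^ k * of_nat (Suc m choose k) * f k)
    = (\<Sum>k\<le>m. (-1) ^ k * of_nat (m choose k) * (f k - f (Suc k)))"
proof -
  \<comment> \<open>The range goes up to \<open>Suc m\<close>, where \<open>m choose k\<close> is 0,
    so that splitting off k = 0 gives exactly one of the two sums that Pascal's rule
    produces.\<close>
  have shift: "(\<Sum>k\<le>Suc m. (-1) ^ k * of_nat (m choose k) * f k)
      = f 0 - (\<Sum>k\<le>m. (-1) ^ k * of_nat (m choose Suc k) * f (Suc k))"
    by (simp add: sum.atMost_Suc_shift sum_negf del: sum.atMost_Suc)
  have "(\<Sum>k\<le>Suc m. (-1) ^ k * of_nat (Suc m choose k) * f k)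
      = f 0 - (\<Sum>k\<le>m. (-1) ^ k * of_nat (Suc m choose Suc k) * f (Suc k))"
    by (simp add: sum.atMost_Suc_shift sum_negf del: sum.atMost_Suc binomial_Suc_Suc)
  also have "\<dots> = f 0 - (\<Sum>k\<le>m. (-1) ^ k * of_nat (m choose Suc k) * f (Suc k))
      - (\<Sum>k\<le>m. (-1) ^ k * of_nat (m choose k) * f (Suc k))"
    by (simp add: algebra_simps sum.distrib)
  also have "\<dots> = (\<Sum>k\<le>m. (-1) ^ k * of_nat (m choose k) * f k)
      - (\<Sum>k\<le>m. (-1) ^ k * of_nat (m choose k) * f (Suc k))"
    unfolding shift[symmetric] by (simp add: binomial_eq_0)
  finally show ?thesis
    by (simp add: algebra_simps sum_subtractf)
qed

text \<open>As a function of k, \<open>(x + k) choose p\<close> is a polynomial of degree p, so m >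
  p differences annihilate it. In the induction each difference lowers p by one, with a change of
  sign.\<close>

lemma alternating_sum_choose_choose_eq_0:
  assumes "p < m"
  shows "(\<Sum>k\<le>m. (-1) ^ k * of_nat (m choose k) * of_nat ((x + k) choose p))
    = (0::'a::comm_ring_1)"
  using assms
proof (induction m arbitrary: p)
  case 0
  then show ?case by simp
next
  case (Suc m)
  show ?case
  proof (cases p)
    case 0
    then show ?thesis
      unfolding alternating_sum_binomial_Suc by simp
  next
    case (Suc q)
    have "(\<Sum>k\<le>Suc m. (-1) ^ k * of_nat (Suc m choose k) * of_nat ((x + k) choose p))
        = - (\<Sum>k\<le>m. (-1) ^ k * of_nat (m choose k) * (of_nat ((x + k) choose q)::'a))"
      unfolding alternating_sum_binomial_Suc by (simp add: Suc sum_negf)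
    also have "\<dots> = 0"
      using Suc.IH[of q] Suc.prems Suc by simp
    finally show ?thesis .
  qed
qed

text \<open>With i = r - s, the quantities c - i - 1 and N - r of the entry become a + s - 1 and a +
  b. The upper argument is -1 exactly when a = s = 0, and the generalized coefficient is then
  1.\<close>

definition star_weight :: "nat \<Rightarrow> nat \<Rightarrow> nat \<Rightarrow> real" where
  "star_weight a b s =
     (-1) ^ s * ((real a + real s - 1) gchoose s) / (real ((a + b) choose a) * real (b choose s))"

text \<open>Isolates the dependence on s: the right side is a constant times a polynomial of degree
  m - 1 in s.\<close>

lemma star_weight_factor:
  assumes "0 < m" "m \<le> b" "s \<le> m" "0 < a"
  shows "((real a + real s - 1) gchoose s) * real ((a + b - m) choose (b - s)) / real (b choose s)
    = fact (m - 1) * fact (a + b - m) / (fact (a - 1) * fact b) * real ((a - 1 + s) choose (m - 1))"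
proof (cases "m \<le> a + s")
  case False
  \<comment> \<open>Both sides vanish: a + s < m means a + b - m < b - s and a - 1 + s < m -
    1.\<close>
  then show ?thesis
    using assms by (simp add: binomial_eq_0)
next
  case True
  \<comment> \<open>Since a > 0, the upper argument is a natural number and \<open>gchoose\<close>
    is an ordinary binomial coefficient; all four coefficients can then be written in
    factorials.\<close>
  have "real a + real s - 1 = real (a + s - 1)"
    using assms by (simp add: of_nat_diff)
  then have 1: "((real a + real s - 1) gchoose s) = fact (a + s - 1) / (fact s * fact (a - 1))"
    using assms binomial_fact[of s "a + s - 1", where 'a = real]
    by (simp only: flip: binomial_gbinomial) simp
  have "a + b - m - (b - s) = a + s - m"
    using assms True by simp
  then have 2: "real ((a + b - m) choose (b - s)) = fact (a + b - m) / (fact (b - s) * fact (a + s - m))"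
    using assms True binomial_fact[of "b - s" "a + b - m", where 'a = real] by simp
  have 3: "real (b choose s) = fact b / (fact s * fact (b - s))"
    using assms by (simp add: binomial_fact)
  have "a - 1 + s - (m - 1) = a + s - m" "a - 1 + s = a + s - 1"
    using assms True by simp_all
  then have 4: "real ((a - 1 + s) choose (m - 1)) = fact (a + s - 1) / (fact (m - 1) * fact (a + s - m))"
    using assms True binomial_fact[of "m - 1" "a + s - 1", where 'a = real] by simp
  show ?thesis
    unfolding 1 2 3 4 by (simp add: field_simps)
qed

lemma sum_star_weight:
  assumes "m \<le> b"
  shows "(\<Sum>s\<le>b. real (m choose s) * real ((a + b - m) choose (b - s)) * star_weight a b s)
    = (if m = 0 then 1 else 0)"
proof -
  let ?t = "\<lambda>s. real (m choose s) * real ((a + b - m) choose (b - s)) * star_weight a b s"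
  have restrict: "(\<Sum>s\<le>b. ?t s) = (\<Sum>s\<le>m. ?t s)"
    using assms by (intro sum.mono_neutral_right) (auto simp: binomial_eq_0)
  consider "m = 0" | "m > 0" "a = 0" | "m > 0" "a > 0"
    by blast
  then show ?thesis
  proof cases
    case 1
    \<comment> \<open>For m = 0 only s = 0 remains, and its count \<open>(a + b) choose b\<close>
      cancels the denominator of the weight.\<close>
    have "(a + b) choose b = (a + b) choose a"
      using binomial_symmetric[of b "a + b"] by simp
    then show ?thesis
      using 1 restrict by (simp add: star_weight_def)
  next
    case 2
    \<comment> \<open>For a = 0 every term vanishes: at s = 0 because b - m < b, and at s = k + 1
      because the numerator of the weight is \<open>k choose Suc k\<close>.\<close>
    have "?t s = 0" for s
    proof (cases s)
      case 0
      then show ?thesis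
        using 2 assms by (simp add: binomial_eq_0)
    next
      case (Suc k)
      then show ?thesis
        using 2 by (simp add: star_weight_def binomial_eq_0 flip: binomial_gbinomial)
    qed
    then have "(\<Sum>s\<le>b. ?t s) = 0"
      by (intro sum.neutral ballI)
    then show ?thesis
      using 2 by simp
  next
    case 3
    \<comment> \<open>The factors independent of s: the constant of
      \<open>star_weight_factor\<close> over the first denominator of the weight.\<close>
    let ?K = "fact (m - 1) * fact (a + b - m) / (fact (a - 1) * fact b) / real ((a + b) choose a)"
    have "?t s = ?K * ((-1) ^ s * of_nat (m choose s) * of_nat ((a - 1 + s) choose (m - 1)))"
      if "s \<le> m" for s
    proof -
      have "?t s = (-1) ^ s * real (m choose s) / real ((a + b) choose a) *
          (((real a + real s - 1) gchoose s) * real ((a + b - m) choose (b - s)) / real (b choose s))"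
        by (simp add: star_weight_def)
      then show ?thesis
        unfolding star_weight_factor[OF 3(1) assms that 3(2)] by (simp add: mult_ac)
    qed
    then have "(\<Sum>s\<le>m. ?t s)
        = ?K * (\<Sum>s\<le>m. (-1) ^ s * of_nat (m choose s) * of_nat ((a - 1 + s) choose (m - 1)))"
      unfolding sum_distrib_left by (intro sum.cong) auto
    also have "\<dots> = 0"
      using alternating_sum_choose_choose_eq_0[of "m - 1" m "a - 1", where 'a = real] 3 by simp
    finally show ?thesis
      using restrict 3 by simp
  qed
qed

section \<open>The products of the two matrices\<close>

text \<open>S corresponds to the pair of S \<inter> A and S - A, which are chosen independently
  inside A and U - A.\<close>

lemma card_subsets_card_Int:
  assumes "finite U" "A \<subseteq> U" "s \<le> b"
  shows "card {S. S \<subseteq> U \<and> card S = b \<and> card (S \<inter> A) = s}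
    = (card A choose s) * ((card U - card A) choose (b - s))"
proof -
  let ?L = "{S. S \<subseteq> U \<and> card S = b \<and> card (S \<inter> A) = s}"
  let ?X = "{X. X \<subseteq> A \<and> card X = s}" and ?Y = "{Y. Y \<subseteq> U - A \<and> card Y = b - s}"
  have fin: "finite S" if "S \<subseteq> U" for S
    using that assms finite_subset by blast
  have split: "card S = card (S \<inter> A) + card (S - A)" if "S \<subseteq> U" for S
    using card_Int_Diff[OF fin[OF that]] by blast
  have "bij_betw (\<lambda>S. (S \<inter> A, S - A)) ?L (?X \<times> ?Y)"
  proof (rule bij_betw_byWitness[where f' = "\<lambda>(X, Y). X \<union> Y"])
    show "(\<lambda>S. (S \<inter> A, S - A)) ` ?L \<subseteq> ?X \<times> ?Y"
      using split by auto
    have "X \<union> Y \<in> ?L" if "X \<in> ?X" "Y \<in> ?Y" for X Y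
    proof -
      have "(X \<union> Y) \<inter> A = X" "(X \<union> Y) - A = Y" "X \<union> Y \<subseteq> U"
        using that assms by auto
      then show ?thesis
        using that assms split[of "X \<union> Y"] by simp
    qed
    then show "(\<lambda>(X, Y). X \<union> Y) ` (?X \<times> ?Y) \<subseteq> ?L"
      by (intro image_subsetI, elim SigmaE) simp
  qed (use assms in auto)
  then have "card ?L = card ?X * card ?Y"
    by (simp add: bij_betw_same_card card_cartesian_product)
  then show ?thesis
    using assms fin by (simp add: n_subsets card_Diff_subset)
qed

text \<open>Grouping the sets S by |S \<inter> A| gives the shape of \<open>sum_star_weight\<close>,
  with |A| as m and |U| as a + b.\<close>

lemma sum_subsets_card_Int:
  fixes g :: "nat \<Rightarrow> real"
  assumes "finite U" "A \<subseteq> U"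
  shows "(\<Sum>S | S \<subseteq> U \<and> card S = b. g (card (S \<inter> A)))
    = (\<Sum>s\<le>b. real (card A choose s) * real ((card U - card A) choose (b - s)) * g s)"
proof -
  let ?P = "{S. S \<subseteq> U \<and> card S = b}"
  have fin: "finite ?P"
    using assms by simp
  have "(\<lambda>S. card (S \<inter> A)) ` ?P \<subseteq> {..b}"
    using assms by (auto intro!: card_mono intro: finite_subset)
  then have "(\<Sum>S\<in>?P. g (card (S \<inter> A)))
      = (\<Sum>s\<le>b. \<Sum>S | S \<in> ?P \<and> card (S \<inter> A) = s. g (card (S \<inter> A)))"
    using sum.group[OF fin, of "{..b}" "\<lambda>S. card (S \<inter> A)" "\<lambda>S. g (card (S \<inter> A))"] by simp
  also have "\<dots> = (\<Sum>s\<le>b. real (card {S. S \<subseteq> U \<and> card S = b \<and> card (S \<inter> A) = s}) * g s)"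
    by (intro sum.cong refl) (simp add: conj_assoc)
  also have "\<dots> = (\<Sum>s\<le>b. real (card A choose s) * real ((card U - card A) choose (b - s)) * g s)"
    using assms by (intro sum.cong refl) (simp add: card_subsets_card_Int)
  finally show ?thesis .
qed

section \<open>Differences of sets of equal size\<close>

lemma finite_subsets_of_size [simp]: "finite (subsets_of_size n k)"
  by (simp add: subsets_of_size_def)

lemma finite_mem_subsets_of_size: "S \<in> subsets_of_size n k \<Longrightarrow> finite S"
  by (auto simp: subsets_of_size_def intro: finite_subset)

text \<open>Both differences have k - |S \<inter> T| elements. This is the source of the symmetry of
  the two products.\<close>

lemma card_Diff_commute_subsets_of_size:
  assumes "S \<in> subsets_of_size n k" "T \<in> subsets_of_size n k"
  shows "card (S - T) = card (T - S)"
  using assms card_Int_Diff[OF finite_mem_subsets_of_size[OF assms(1)], of T]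
    card_Int_Diff[OF finite_mem_subsets_of_size[OF assms(2)], of S]
  by (simp add: subsets_of_size_def Int_commute)

lemma card_Diff_eq_0_subsets_of_size:
  assumes "S \<in> subsets_of_size n k" "T \<in> subsets_of_size n k"
  shows "card (S - T) = 0 \<longleftrightarrow> S = T"
proof -
  have "card (S - T) = 0 \<longleftrightarrow> S \<subseteq> T"
    using finite_mem_subsets_of_size[OF assms(1)] by simp
  then show ?thesis
    using assms finite_mem_subsets_of_size[OF assms(2)] card_subset_eq[of T S]
    by (auto simp: subsets_of_size_def)
qed

text \<open>Substitutes s = r - i, as |R \<inter> C| + |R - C| = r. Since r \<le> c \<le> N, the
  natural subtractions in a and b are exact.\<close>

lemma inclusion_matrix_star_eq_weight:
  assumes "r \<le> c" "C \<in> subsets_of_size n c" "R \<in> subsets_of_size n r"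
  shows "inclusion_matrix_star n r c C R = star_weight (c - r) (max n (r + c) - c) (card (R - C))"
proof -
  let ?N = "max n (r + c)"
  have card: "card (R \<inter> C) + card (R - C) = r"
    using assms(3) card_Int_Diff[OF finite_mem_subsets_of_size[OF assms(3)], of C]
    by (simp add: subsets_of_size_def)
  then have s: "r - card (R \<inter> C) = card (R - C)" and i: "real (card (R \<inter> C)) = real r - real (card (R - C))"
    by linarith+
  have a: "real (c - r) = real c - real r" and "c - r + (?N - c) = ?N - r"
    and "real ?N - real r = real (?N - r)" "real ?N - real c = real (?N - c)"
    using assms by (simp_all add: of_nat_diff)
  then show ?thesis
    using assms unfolding inclusion_matrix_star_def star_weight_def Let_def
    by (simp add: idx_mat_def s binomial_gbinomial i a algebra_simps)
qed

text \<open>Only C containing R contribute. Their complements S are the (n - c)-subsets of [n] - R,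
  to which \<open>sum_subsets_card_Int\<close> applies. The weight keeps b = N - c, which is n - c
  only if r + c \<le> n.\<close>

lemma mult_inclusion_matrix_star:
  assumes "r \<le> c" "c \<le> n" "R \<in> subsets_of_size n r" "R' \<in> subsets_of_size n r"
  shows "idx_mult (subsets_of_size n c) (inclusion_matrix n r c) (inclusion_matrix_star n r c) R R'
    = (\<Sum>s\<le>n - c. real (card (R' - R) choose s) * real ((n - r - card (R' - R)) choose (n - c - s))
        * star_weight (c - r) (max n (r + c) - c) s)"
proof -
  let ?w = "star_weight (c - r) (max n (r + c) - c)"
  let ?U = "{1..n} - R"
  have "idx_mult (subsets_of_size n c) (inclusion_matrix n r c) (inclusion_matrix_star n r c) R R'
      = (\<Sum>C\<in>subsets_of_size n c. if R \<subseteq> C then ?w (card (R' - C)) else 0)"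
    unfolding idx_mult_def using assms
    by (intro sum.cong refl)
      (simp add: inclusion_matrix_star_eq_weight inclusion_matrix_def idx_mat_def)
  also have "\<dots> = (\<Sum>C | C \<in> subsets_of_size n c \<and> R \<subseteq> C. ?w (card (R' - C)))"
    by (simp add: sum.inter_filter)
  also have "\<dots> = (\<Sum>S | S \<subseteq> ?U \<and> card S = n - c. ?w (card (S \<inter> (R' - R))))"
  proof (rule sum.reindex_bij_witness[where i = "\<lambda>S. {1..n} - S" and j = "\<lambda>C. {1..n} - C"])
    fix C assume C: "C \<in> {C. C \<in> subsets_of_size n c \<and> R \<subseteq> C}"
    then show "{1..n} - ({1..n} - C) = C"
      by (auto simp: subsets_of_size_def)
    show "{1..n} - C \<in> {S. S \<subseteq> ?U \<and> card S = n - c}"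
      using C finite_mem_subsets_of_size[of C n c]
      by (auto simp: subsets_of_size_def card_Diff_subset)
    \<comment> \<open>As R \<subseteq> C, every element of R' outside C already lies outside
      R.\<close>
    have "({1..n} - C) \<inter> (R' - R) = R' - C"
      using C assms by (auto simp: subsets_of_size_def)
    then show "?w (card (({1..n} - C) \<inter> (R' - R))) = ?w (card (R' - C))"
      by simp
  next
    fix S assume S: "S \<in> {S. S \<subseteq> ?U \<and> card S = n - c}"
    then show "{1..n} - ({1..n} - S) = S"
      by auto
    have "finite S" "S \<subseteq> {1..n}"
      using S by (auto intro: finite_subset)
    then show "{1..n} - S \<in> {C. C \<in> subsets_of_size n c \<and> R \<subseteq> C}"
      using S assms by (auto simp: subsets_of_size_def card_Diff_subset)
  qed
  also have "\<dots> = (\<Sum>s\<le>n - c. real (card (R' - R) choose s)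
      * real ((card ?U - card (R' - R)) choose (n - c - s)) * ?w s)"
    using assms by (intro sum_subsets_card_Int) (auto simp: subsets_of_size_def)
  also have "card ?U = n - r"
    using assms finite_mem_subsets_of_size[of R n r] by (simp add: subsets_of_size_def card_Diff_subset)
  finally show ?thesis .
qed

text \<open>Only r-subsets R of C' contribute, and for these R - C = R \<inter> (C' - C), so the
  count takes place inside C' without complements.\<close>

lemma mult_star_inclusion_matrix:
  assumes "r \<le> c" "C \<in> subsets_of_size n c" "C' \<in> subsets_of_size n c"
  shows "idx_mult (subsets_of_size n r) (inclusion_matrix_star n r c) (inclusion_matrix n r c) C C'
    = (\<Sum>s\<le>r. real (card (C' - C) choose s) * real ((c - card (C' - C)) choose (r - s))
        * star_weight (c - r) (max n (r + c) - c) s)"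
proof -
  let ?w = "star_weight (c - r) (max n (r + c) - c)"
  have "idx_mult (subsets_of_size n r) (inclusion_matrix_star n r c) (inclusion_matrix n r c) C C'
      = (\<Sum>R\<in>subsets_of_size n r. if R \<subseteq> C' then ?w (card (R - C)) else 0)"
    unfolding idx_mult_def using assms
    by (intro sum.cong refl)
      (simp add: inclusion_matrix_star_eq_weight inclusion_matrix_def idx_mat_def)
  also have "\<dots> = (\<Sum>R | R \<in> subsets_of_size n r \<and> R \<subseteq> C'. ?w (card (R - C)))"
    by (simp add: sum.inter_filter)
  also have "\<dots> = (\<Sum>S | S \<subseteq> C' \<and> card S = r. ?w (card (S \<inter> (C' - C))))"
  proof (rule sum.cong)
    show "{R. R \<in> subsets_of_size n r \<and> R \<subseteq> C'} = {S. S \<subseteq> C' \<and> card S = r}"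
      using assms by (auto simp: subsets_of_size_def)
    fix S assume "S \<in> {S. S \<subseteq> C' \<and> card S = r}"
    then have "S \<inter> (C' - C) = S - C"
      by auto
    then show "?w (card (S - C)) = ?w (card (S \<inter> (C' - C)))"
      by simp
  qed
  also have "\<dots> = (\<Sum>s\<le>r. real (card (C' - C) choose s)
      * real ((card C' - card (C' - C)) choose (r - s)) * ?w s)"
    using assms finite_mem_subsets_of_size by (intro sum_subsets_card_Int) auto
  also have "card C' = c"
    using assms by (simp add: subsets_of_size_def)
  finally show ?thesis .
qed

section \<open>From entries to matrix identities\<close>

lemma inclusion_matrix_mem: "inclusion_matrix n r c \<in> idx_mats (subsets_of_size n r) (subsets_of_size n c)"
  by (simp add: inclusion_matrix_def idx_mat_def idx_mats_def)

lemma inclusion_matrix_star_mem: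
  "inclusion_matrix_star n r c \<in> idx_mats (subsets_of_size n c) (subsets_of_size n r)"
  by (simp add: inclusion_matrix_star_def idx_mat_def idx_mats_def)

lemma idx_mult_outside:
  assumes "A \<in> idx_mats I J" "B \<in> idx_mats J K" "\<not> (i \<in> I \<and> k \<in> K)"
  shows "idx_mult J A B i k = 0"
  using assms by (auto simp: idx_mats_def idx_mult_def intro!: sum.neutral)

lemma idx_mult_eq_idx_oneI:
  assumes "A \<in> idx_mats I J" "B \<in> idx_mats J I"
    and "\<And>i k. i \<in> I \<Longrightarrow> k \<in> I \<Longrightarrow> idx_mult J A B i k = (if i = k then 1 else 0)"
  shows "idx_mult J A B = idx_one I"
proof (intro ext)
  fix i k
  show "idx_mult J A B i k = idx_one I i k"
    using assms(3) idx_mult_outside[OF assms(1,2), of i k] by (auto simp: idx_one_def idx_mat_def)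
qed

lemma idx_transpose_mult_eqI:
  assumes "A \<in> idx_mats I J" "B \<in> idx_mats J I"
    and "\<And>i k. i \<in> I \<Longrightarrow> k \<in> I \<Longrightarrow> idx_mult J A B i k = idx_mult J A B k i"
  shows "idx_transpose (idx_mult J A B) = idx_mult J A B"
proof (intro ext)
  fix i k
  show "idx_transpose (idx_mult J A B) i k = idx_mult J A B i k"
    using assms(3) idx_mult_outside[OF assms(1,2), of i k] idx_mult_outside[OF assms(1,2), of k i]
    by (cases "i \<in> I \<and> k \<in> I") (auto simp: idx_transpose_def)
qed

text \<open>Here N = n, so b = n - c and a + b = n - r. The bound m \<le> b of
  \<open>sum_star_weight\<close> holds because |R' - R| \<le> r \<le> n - c.\<close>

lemma inclusion_matrix_right_inverse:
  assumes "r \<le> c" "r + c \<le> n"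
  shows "idx_mult (subsets_of_size n c) (inclusion_matrix n r c) (inclusion_matrix_star n r c)
    = idx_one (subsets_of_size n r)"
proof (rule idx_mult_eq_idx_oneI[OF inclusion_matrix_mem inclusion_matrix_star_mem])
  fix R R' assume R: "R \<in> subsets_of_size n r" "R' \<in> subsets_of_size n r"
  have "card (R' - R) \<le> card R'"
    using finite_mem_subsets_of_size[OF R(2)] by (intro card_mono) auto
  then have "card (R' - R) \<le> n - c"
    using R assms by (simp add: subsets_of_size_def)
  moreover have "c - r + (n - c) = n - r" "max n (r + c) = n"
    using assms by auto
  ultimately show "idx_mult (subsets_of_size n c) (inclusion_matrix n r c) (inclusion_matrix_star n r c) R R'
      = (if R = R' then 1 else 0)"
    using sum_star_weight[of "card (R' - R)" "n - c" "c - r"]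
      mult_inclusion_matrix_star[OF assms(1) _ R] assms card_Diff_eq_0_subsets_of_size[OF R(2,1)]
    by auto
qed

text \<open>Here N = r + c, so b = r and a + b = c. The bound m \<le> b holds because C' - C lies in
  the complement of C, which has n - c \<le> r elements.\<close>

lemma inclusion_matrix_left_inverse:
  assumes "r \<le> c" "c \<le> n" "n \<le> r + c"
  shows "idx_mult (subsets_of_size n r) (inclusion_matrix_star n r c) (inclusion_matrix n r c)
    = idx_one (subsets_of_size n c)"
proof (rule idx_mult_eq_idx_oneI[OF inclusion_matrix_star_mem inclusion_matrix_mem])
  fix C C' assume C: "C \<in> subsets_of_size n c" "C' \<in> subsets_of_size n c"
  have "card (C' - C) \<le> card ({1..n} - C)"
    using C by (intro card_mono) (auto simp: subsets_of_size_def)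
  also have "\<dots> = n - c"
    using C finite_mem_subsets_of_size[OF C(1)] by (simp add: subsets_of_size_def card_Diff_subset)
  finally have "card (C' - C) \<le> r"
    using assms by simp
  moreover have "c - r + r = c" "max n (r + c) - c = r"
    using assms by auto
  ultimately show "idx_mult (subsets_of_size n r) (inclusion_matrix_star n r c) (inclusion_matrix n r c) C C'
      = (if C = C' then 1 else 0)"
    using sum_star_weight[of "card (C' - C)" r "c - r"]
      mult_star_inclusion_matrix[OF assms(1) C] card_Diff_eq_0_subsets_of_size[OF C(2,1)]
    by auto
qed

theorem theorem2p3:
  fixes r c n :: nat
  assumes "r \<le> c" and "c \<le> n"
  shows "is_moore_penrose (subsets_of_size n r) (subsets_of_size n c)
           (inclusion_matrix n r c) (inclusion_matrix_star n r c)
       \<and> moore_penrose (subsets_of_size n r) (subsets_of_size n c) (inclusion_matrix n r c)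
           = inclusion_matrix_star n r c"
proof -
  let ?I = "subsets_of_size n r" and ?J = "subsets_of_size n c"
  let ?M = "inclusion_matrix n r c" and ?G = "inclusion_matrix_star n r c"
  note mem = inclusion_matrix_mem inclusion_matrix_star_mem
  \<comment> \<open>Both symmetries hold however n compares with r + c: exchanging the two index
    sets preserves the size of their difference, the only quantity in the entry formulas that
    depends on them.\<close>
  have sym: "idx_transpose (idx_mult ?J ?M ?G) = idx_mult ?J ?M ?G"
    "idx_transpose (idx_mult ?I ?G ?M) = idx_mult ?I ?G ?M"
  proof -
    show "idx_transpose (idx_mult ?J ?M ?G) = idx_mult ?J ?M ?G"
    proof (rule idx_transpose_mult_eqI[OF mem])
      fix R R' assume R: "R \<in> ?I" "R' \<in> ?I"
      show "idx_mult ?J ?M ?G R R' = idx_mult ?J ?M ?G R' R"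
        unfolding mult_inclusion_matrix_star[OF assms R]
          mult_inclusion_matrix_star[OF assms R(2,1)]
          card_Diff_commute_subsets_of_size[OF R] ..
    qed
    show "idx_transpose (idx_mult ?I ?G ?M) = idx_mult ?I ?G ?M"
    proof (rule idx_transpose_mult_eqI[OF mem(2,1)])
      fix C C' assume C: "C \<in> ?J" "C' \<in> ?J"
      show "idx_mult ?I ?G ?M C C' = idx_mult ?I ?G ?M C' C"
        unfolding mult_star_inclusion_matrix[OF assms(1) C]
          mult_star_inclusion_matrix[OF assms(1) C(2,1)]
          card_Diff_commute_subsets_of_size[OF C] ..
    qed
  qed
  have "is_moore_penrose ?I ?J ?M ?G"
  proof (cases "r + c \<le> n")
    case True
    then show ?thesis
      using is_moore_penrose_right_inverse[OF _ mem _ sym] inclusion_matrix_right_inverse assms by simp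
  next
    case False
    then show ?thesis
      using is_moore_penrose_left_inverse[OF _ mem _ sym] inclusion_matrix_left_inverse assms by simp
  qed
  then show ?thesis
    using moore_penrose_eqI by blast
qed

end
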